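(* Let $(d_N)_{N\ge1}$ be an arbitrary sequence of reals satisfying $\frac{1}{2N}\le d_N\le 1$ for all $N\ge 1$ and $\lim_{N\to\infty}d_N=0$. For each $N$ let $$P_N^{(d_N)}:=\sup_{\omega}\prod_{k=1}^N 2\sin(\pi x_k),$$ where the supremum is taken over all $N$-element point sets (with multiplicities allowed) $\omega=\{x_1,\dots,x_N\}$ in $[0,1]$ whose star-discrepancy satisfies $D_N^*(\omega)\le d_N$. Then: a) For all $\varepsilon>0$ there exist $c(\varepsilon)$ and $N(\varepsilon)$ such that for all $N>N(\varepsilon)$ we have $$P_N^{(d_N)}\le c(\varepsilon)\,\frac1N\left(\left(\frac{\mathrm e}{\pi}+\varepsilon\right)\frac1{d_N}\right)^{2Nd_N}.$$ b) For all sufficiently large $N$ we have $$P_N^{(d_N)}\ge \frac{2\pi^2}{\mathrm e^6}\,\frac1N\left(\frac{\mathrm e}{\pi}\,\frac1{d_N}\right)^{2Nd_N}.$$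
   Context: For $x_1,\dots,x_N\in[0,1]$ (not necessarily distinct) the star-discrepancy of $\omega=\{x_1,\dots,x_N\}$ is $D_N^*(\omega)=\sup_{a\in[0,1]}\left|\frac{A_N(a)}{N}-a\right|$, where $A_N(a)=\#\{1\le n\le N: x_n\in[0,a)\}$. *)

theory Defs
  imports "HOL-Analysis.Analysis"
begin

text \<open>
  An \<open>N\<close>-element point set with multiplicities is a family \<open>x 1, \<dots>, x N\<close>;
  values of \<open>x\<close> outside \<open>{1..N}\<close> are irrelevant.
\<close>

definition counting_fun :: "nat \<Rightarrow> (nat \<Rightarrow> real) \<Rightarrow> real \<Rightarrow> nat" where
  "counting_fun N x a = card {n \<in> {1..N}. x n \<in> {0..<a}}"

text \<open>
  For \<open>N \<ge> 1\<close> the set under the supremum is bounded by \<open>1\<close>, so the real-valued supremum is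
  the genuine one.
\<close>

definition star_discrepancy :: "nat \<Rightarrow> (nat \<Rightarrow> real) \<Rightarrow> real" where
  "star_discrepancy N x = (SUP a\<in>{0..1}. \<bar>real (counting_fun N x a) / real N - a\<bar>)"

definition admissible_point_sets :: "nat \<Rightarrow> real \<Rightarrow> (nat \<Rightarrow> real) set" where
  "admissible_point_sets N \<delta> = {x. (\<forall>n\<in>{1..N}. x n \<in> {0..1}) \<and> star_discrepancy N x \<le> \<delta>}"

text \<open>
  The products lie in \<open>{0..2 ^ N}\<close>, and for \<open>N \<ge> 1\<close> and \<open>\<delta> \<ge> 1 / (2 * N)\<close> the points
  \<open>(2 * n - 1) / (2 * N)\<close> are admissible. Hence in that range this is a supremum of a
  nonempty bounded set.
\<close>

definition max_sine_product :: "nat \<Rightarrow> real \<Rightarrow> real" where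
  "max_sine_product N \<delta> =
     (SUP x\<in>admissible_point_sets N \<delta>. \<Prod>k=1..N. 2 * sin (pi * x k))"

end

theory Submission
  imports Defs
begin

text \<open>
  Put \<open>M = N * d\<close>. A point set has star-discrepancy at most \<open>d\<close> iff its \<open>i\<close>-th smallest point lies
  in \<open>[i / N - d, (i - 1) / N + d]\<close>, so the product is largest when every point is moved as close to
  \<open>1 / 2\<close> as these intervals permit. The maximum \<open>T M\<close> behaves like a Gamma function in \<open>M\<close>:
  \<open>T (1 / 2) = 2\<close> (evaluate \<open>z ^ N + 1\<close> at \<open>1\<close>), \<open>T (M + 1) = T M / (sin (pi * M / N))\<^sup>2\<close> for
  \<open>M \<le> N / 2\<close>, and \<open>T\<close> is log-concave. Log-concavity determines \<open>T\<close> up to constant factors for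
  \<open>M\<close> between \<open>1 / 2\<close> and \<open>3 / 2\<close>; from there the functional equation is compared with the growth of
  \<open>(q * N / M) powr (2 * M)\<close> under \<open>M \<mapsto> M + 1\<close>.
\<close>

section \<open>Sine inequalities and a sine product from roots of unity\<close>

lemma concave_on_sin: "concave_on {0..pi} (sin :: real \<Rightarrow> real)"
  by (rule f''_le0_imp_concave[where f' = cos and f'' = "\<lambda>x. - sin x"])
     (auto intro!: derivative_eq_intros sin_ge_zero)

text \<open>By concavity the sine lies above its chord from \<open>0\<close> to
  \<open>pi / 2\<close> (Jordan's inequality).\<close>

lemma sin_ge_linear:
  fixes x :: real
  assumes "0 \<le> x" "x \<le> 1 / 2"
  shows "2 * x \<le> sin (pi * x)"
  using concave_onD[OF concave_on_sin, of "2 * x" 0 "pi / 2"] assms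
  by (simp add: mult.commute)

text \<open>Both sides are monic polynomials in \<open>w\<close> of degree \<open>n\<close> that
  agree at the \<open>n\<close> roots of unity; their difference has degree below \<open>n\<close>
  and therefore vanishes.\<close>

lemma prod_minus_roots_unity:
  fixes w :: complex
  assumes "n > 0"
  shows "(\<Prod>k<n. w - cis (2 * pi * real k / real n)) = w ^ n - 1"
proof -
  let ?z = "\<lambda>k. cis (2 * pi * real k / real n)"
  let ?p = "\<Prod>k<n. [:- ?z k, 1:]"
  let ?q = "monom 1 n - 1 :: complex poly"
  have deg: "degree ?p = n" by (subst degree_prod_eq_sum_degree) auto
  have "lead_coeff ?p = 1" by (subst lead_coeff_prod) auto
  have "?p = ?q"
  proof (rule poly_eqI_degree_lead_coeff[where n = n and A = "{z. z ^ n = 1}"])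
    show "poly.coeff ?p n = poly.coeff ?q n"
      using \<open>lead_coeff ?p = 1\<close> deg assms by simp
    show "degree ?q \<le> n" by (intro degree_diff_le) (auto simp: degree_monom_le)
    show "poly ?p z = poly ?q z" if "z \<in> {z. z ^ n = 1}" for z
    proof -
      have "z \<in> ?z ` {..<n}"
        using bij_betw_imp_surj_on[OF Complex.bij_betw_roots_unity[OF assms]] that by blast
      then have "poly ?p z = 0" by (auto simp: poly_prod intro!: prod_zero)
      then show ?thesis using that by (simp add: poly_monom)
    qed
  qed (use deg assms card_roots_unity_eq in auto)
  then have "poly ?p w = poly ?q w" by simp
  then show ?thesis by (simp add: poly_prod poly_monom)
qed

text \<open>Each factor is the distance from \<open>cis (- (pi / N))\<close> to an
  \<open>N\<close>-th root of unity. The \<open>N\<close>-th power of that point is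
  \<open>-1\<close>, so the product is the modulus of \<open>-1 - 1\<close>.\<close>

lemma prod_sin_half_odd:
  assumes "N > 0"
  shows "(\<Prod>j<N. 2 * sin (pi * ((real j + 1 / 2) / real N))) = 2"
proof -
  let ?w = "cis (- (pi / real N))"
  have eq: "cmod (?w - cis (2 * pi * real j / real N)) = 2 * sin (pi * ((real j + 1 / 2) / real N))"
    if "j < N" for j
  proof -
    let ?y = "(real j + 1 / 2) / real N"
    have "?w - cis (2 * pi * real j / real N) = ?w * (1 - exp (\<i> * of_real (2 * (pi * ?y))))"
    proof -
      have "2 * pi * real j / real N = - (pi / real N) + 2 * (pi * ?y)"
        using assms by (simp add: field_simps)
      then show ?thesis by (simp only: right_diff_distrib cis_mult flip: cis_conv_exp) simp
    qed
    then have "cmod (?w - cis (2 * pi * real j / real N)) = cmod (exp (\<i> * of_real (2 * (pi * ?y))) - 1)"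
      by (simp add: norm_mult norm_minus_commute)
    also have "\<dots> = 2 * \<bar>sin (pi * ?y)\<bar>"
      using dist_exp_i_1[of "2 * (pi * ?y)"] by simp
    also have "\<bar>sin (pi * ?y)\<bar> = sin (pi * ?y)"
    proof (intro abs_of_nonneg sin_ge_zero)
      have "?y \<le> 1" using that by (simp add: field_simps)
      then show "pi * ?y \<le> pi" using mult_left_mono[of ?y 1 pi] by simp
    qed simp
    finally show ?thesis .
  qed
  have "?w ^ N = -1" using assms by (auto simp: Complex.DeMoivre complex_eq_iff)
  then have "cmod (\<Prod>j<N. ?w - cis (2 * pi * real j / real N)) = 2"
    by (simp add: prod_minus_roots_unity[OF assms])
  then show ?thesis by (simp add: prod_norm[symmetric] eq)
qed

section \<open>The extremal product and its functional equation\<close>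

text \<open>For \<open>s \<ge> 0\<close>, the largest factor contributed by a point whose distance
  to the nearer end of the unit interval is at most \<open>s / N\<close>.\<close>

definition capped_sine :: "nat \<Rightarrow> real \<Rightarrow> real" where
  "capped_sine N s = 2 * sin (pi * min (s / real N) (1 / 2))"

text \<open>Here \<open>M\<close> stands for \<open>N * d\<close>. Counted from \<open>0\<close>,
  the \<open>j\<close>-th smallest point is at most \<open>(j + M) / N\<close> away from
  \<open>0\<close> and at most \<open>(N - 1 - j + M) / N\<close> away from \<open>1\<close>; the
  smaller bound limits its factor.\<close>

definition extremal_product :: "nat \<Rightarrow> real \<Rightarrow> real" where
  "extremal_product N M = (\<Prod>j<N. capped_sine N (real (min j (N - 1 - j)) + M))"

lemma capped_sine_le:
  assumes "N > 0" "s > 0"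
  shows "capped_sine N s \<le> 2 * (pi * (s / real N))"
proof -
  have "sin (pi * min (s / N) (1/2)) \<le> pi * min (s / N) (1/2)"
    using assms by (intro sin_x_le_x) auto
  also have "\<dots> \<le> pi * (s / N)" by (intro mult_left_mono) auto
  finally show ?thesis by (simp add: capped_sine_def)
qed

lemma capped_sine_ge:
  assumes "s \<ge> 0"
  shows "4 * min (s / real N) (1 / 2) \<le> capped_sine N s"
  using sin_ge_linear[of "min (s / real N) (1 / 2)", OF _ min.cobounded2] assms
  by (simp add: capped_sine_def)

lemma capped_sine_pos: "N > 0 \<Longrightarrow> s > 0 \<Longrightarrow> 0 < capped_sine N s"
  by (rule less_le_trans[OF _ capped_sine_ge]) auto

lemma capped_sine_cap: "N > 0 \<Longrightarrow> s \<ge> real N / 2 \<Longrightarrow> capped_sine N s = 2"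
  by (simp add: capped_sine_def min_absorb2 field_simps)

lemma sine_le_capped_sine:
  assumes "0 \<le> y" "y \<le> 1 / 2" "y \<le> s / real N"
  shows "2 * sin (pi * y) \<le> capped_sine N s"
  unfolding capped_sine_def
  using assms by (intro mult_left_mono sin_monotone_2pi_le mult_left_mono)
    (auto simp: field_simps intro: order_trans[of _ 0])

text \<open>Weighted AM-GM reduces the claim to ordinary concavity, which holds because the sine and
  the minimum are concave and the sine increases up to \<open>pi / 2\<close>.\<close>

lemma capped_sine_log_concave:
  assumes N: "N > 0" and uv: "u \<ge> 0" "v \<ge> 0" "u + v = 1" and st: "s > 0" "t > 0"
  shows "capped_sine N s powr u * capped_sine N t powr v \<le> capped_sine N (u * s + v * t)"
proof -
  let ?m = "\<lambda>s. min (s / real N) (1 / 2)"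
  have "capped_sine N s powr u * capped_sine N t powr v
      \<le> u * capped_sine N s + v * capped_sine N t"
    by (intro Youngs_inequality_0 capped_sine_pos uv N st)
  also have "\<dots> \<le> 2 * sin (u * (pi * ?m s) + v * (pi * ?m t))"
  proof -
    have "pi * ?m r \<in> {0..pi}" if "r > 0" for r
    proof -
      have "?m r \<le> 1" by simp
      then have "pi * ?m r \<le> pi * 1" by (intro mult_left_mono) auto
      then show ?thesis using that by simp
    qed
    then have "u * sin (pi * ?m s) + v * sin (pi * ?m t) \<le> sin (u * (pi * ?m s) + v * (pi * ?m t))"
      using concave_on_sin uv st unfolding concave_on_iff real_scaleR_def by blast
    then show ?thesis unfolding capped_sine_def by linarith
  qed
  also have "\<dots> = 2 * sin (pi * (u * ?m s + v * ?m t))" by (simp add: algebra_simps)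
  also have "\<dots> \<le> capped_sine N (u * s + v * t)"
  proof (rule sine_le_capped_sine)
    have "u * ?m s + v * ?m t \<le> u * (1 / 2) + v * (1 / 2)"
      using uv by (intro add_mono mult_left_mono min.cobounded2)
    then show "u * ?m s + v * ?m t \<le> 1 / 2" using uv by (simp add: field_simps)
    have "u * ?m s + v * ?m t \<le> u * (s / N) + v * (t / N)"
      using uv by (intro add_mono mult_left_mono) auto
    then show "u * ?m s + v * ?m t \<le> (u * s + v * t) / real N" by (simp add: add_divide_distrib)
  qed (use uv st in auto)
  finally show ?thesis .
qed

lemma extremal_product_pos: "N > 0 \<Longrightarrow> M > 0 \<Longrightarrow> 0 < extremal_product N M"
  unfolding extremal_product_def by (intro prod_pos ballI capped_sine_pos) auto

lemma extremal_product_log_concave: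
  assumes "N > 0" "u \<ge> 0" "v \<ge> 0" "u + v = 1" "s > 0" "t > 0"
  shows "extremal_product N s powr u * extremal_product N t powr v
    \<le> extremal_product N (u * s + v * t)"
  unfolding extremal_product_def prod_powr_distrib prod.distrib[symmetric]
proof (intro prod_mono conjI)
  fix j
  let ?k = "real (min j (N - 1 - j))"
  have "u * (?k + s) + v * (?k + t) = (u + v) * ?k + (u * s + v * t)" by algebra
  then show "capped_sine N (?k + s) powr u * capped_sine N (?k + t) powr v
      \<le> capped_sine N (?k + (u * s + v * t))"
    using capped_sine_log_concave[of N u v "?k + s" "?k + t"] assms by simp
qed auto

text \<open>At \<open>M = 1 / 2\<close> the cap changes no factor, and reflecting the second half by
  \<open>sin (pi - x) = sin x\<close> gives the sine product over the regular grid.\<close>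

lemma extremal_product_half:
  assumes "N > 0"
  shows "extremal_product N (1 / 2) = 2"
proof -
  have "capped_sine N (real (min j (N - 1 - j)) + 1 / 2) = 2 * sin (pi * ((real j + 1 / 2) / real N))"
    if "j < N" for j
  proof (cases "j \<le> N - 1 - j")
    case True
    then have "(real j + 1 / 2) / real N \<le> 1 / 2" using that by (simp add: field_simps)
    then show ?thesis using True by (simp add: capped_sine_def min_def)
  next
    case False
    let ?y = "(real j + 1 / 2) / real N"
    have *: "(real (N - 1 - j) + 1 / 2) / real N = 1 - ?y"
      using that by (simp add: field_simps of_nat_diff)
    have "1 - ?y \<le> 1 / 2" using False that by (simp add: field_simps)
    then show ?thesis using False * sin_pi_minus[of "pi * ?y"]
      by (simp add: capped_sine_def min_def right_diff_distrib)
  qed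
  then have "extremal_product N (1 / 2) = (\<Prod>j<N. 2 * sin (pi * ((real j + 1 / 2) / real N)))"
    unfolding extremal_product_def by (intro prod.cong) auto
  then show ?thesis using prod_sin_half_odd[OF assms] by simp
qed

text \<open>Splitting at the middle turns the product into two runs of consecutive arguments, in
  which \<open>M \<mapsto> M + 1\<close> is an index shift. For odd \<open>N\<close> the middle
  factor belongs to the first run.\<close>

lemma extremal_product_split:
  "extremal_product N M =
    (\<Prod>j<(N + 1) div 2. capped_sine N (real j + M)) * (\<Prod>j<N div 2. capped_sine N (real j + M))"
proof -
  let ?f = "\<lambda>j. capped_sine N (real (min j (N - 1 - j)) + M)"
  have "{..<N} = {..<(N + 1) div 2} \<union> {(N + 1) div 2..<N}" by auto
  then have "extremal_product N M = prod ?f ({..<(N + 1) div 2} \<union> {(N + 1) div 2..<N})"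
    unfolding extremal_product_def by simp
  also have "\<dots> = prod ?f {..<(N + 1) div 2} * prod ?f {(N + 1) div 2..<N}"
    by (intro prod.union_disjoint) auto
  also have "prod ?f {..<(N + 1) div 2} = (\<Prod>j<(N + 1) div 2. capped_sine N (real j + M))"
    by (intro prod.cong) (auto simp: min_def)
  also have "prod ?f {(N + 1) div 2..<N} = (\<Prod>j<N div 2. capped_sine N (real j + M))"
    by (rule prod.reindex_bij_witness[of _ "\<lambda>j. N - 1 - j" "\<lambda>j. N - 1 - j"])
       (auto simp: min_def)
  finally show ?thesis .
qed

text \<open>In each of the two runs the shift drops the first factor \<open>capped_sine N M\<close>
  and appends one at the far end, which the cap has already made equal to \<open>2\<close>.\<close>

lemma extremal_product_Suc:
  assumes "N > 0" "M \<ge> 1 / 2"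
  shows "extremal_product N (M + 1) = extremal_product N M * (2 / capped_sine N M)\<^sup>2"
proof -
  have shift: "(\<Prod>j<n. capped_sine N (real j + (M + 1))) * capped_sine N M
      = (\<Prod>j<n. capped_sine N (real j + M)) * 2" if "real n + M \<ge> real N / 2" for n
  proof -
    have "(\<Prod>j<n. capped_sine N (real j + (M + 1))) * capped_sine N M
        = (\<Prod>j<Suc n. capped_sine N (real j + M))"
      by (simp only: prod.lessThan_Suc_shift) (simp add: add_ac)
    also have "\<dots> = (\<Prod>j<n. capped_sine N (real j + M)) * 2"
      using capped_sine_cap[OF assms(1) that] by simp
    finally show ?thesis .
  qed
  have pos: "capped_sine N M > 0" using assms by (intro capped_sine_pos) auto
  \<comment> \<open>For odd \<open>N\<close>, \<open>N div 2\<close> is exactly \<open>1 / 2\<close>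
    short of \<open>N / 2\<close>; the assumption \<open>M \<ge> 1 / 2\<close> covers this
    gap.\<close>
  have "real N / 2 \<le> real (N div 2) + 1 / 2" "real N / 2 \<le> real ((N + 1) div 2) + 1 / 2"
    by linarith+
  then have "extremal_product N (M + 1) * (capped_sine N M)\<^sup>2 = extremal_product N M * 2\<^sup>2"
    using shift[of "(N + 1) div 2"] shift[of "N div 2"] assms
    unfolding extremal_product_split power2_eq_square by (simp add: mult_ac) algebra
  then show ?thesis using pos by (simp add: field_simps)
qed

section \<open>Star-discrepancy as interval constraints on the points\<close>

lemma counting_fun_le: "counting_fun N x a \<le> N"
proof -
  have "{n \<in> {1..N}. x n \<in> {0..<a}} \<subseteq> {1..N}" by auto
  from card_mono[OF finite_atLeastAtMost this] show ?thesis
    unfolding counting_fun_def by simp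
qed

lemma abs_le_star_discrepancy:
  assumes "N > 0" "a \<in> {0..1}"
  shows "\<bar>real (counting_fun N x a) / real N - a\<bar> \<le> star_discrepancy N x"
proof -
  have "\<bar>real (counting_fun N x b) / real N - b\<bar> \<le> 1" if "b \<in> {0..1}" for b
  proof -
    have "0 \<le> real (counting_fun N x b) / real N" by simp
    moreover have "real (counting_fun N x b) / real N \<le> 1"
      using counting_fun_le[of N x b] assms(1) by simp
    ultimately show ?thesis using that unfolding atLeastAtMost_iff by linarith
  qed
  then show ?thesis
    unfolding star_discrepancy_def using assms(2)
    by (intro cSUP_upper bdd_aboveI2[where M = 1]) auto
qed

text \<open>The lower bounds confine the indices of points below \<open>a\<close> to
  \<open>1, ..., \<lfloor>N * (a + d)\<rfloor>\<close>; the upper bounds put all of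
  \<open>1, ..., \<lceil>N * (a - d)\<rceil>\<close> among them.\<close>

lemma star_discrepancy_leI:
  assumes "N > 0" "d \<ge> 0"
    and nonneg: "\<And>i. i \<in> {1..N} \<Longrightarrow> 0 \<le> x i"
    and lower: "\<And>i. i \<in> {1..N} \<Longrightarrow> real i / real N - d \<le> x i"
    and upper: "\<And>i. i \<in> {1..N} \<Longrightarrow> x i \<le> (real i - 1) / real N + d"
  shows "star_discrepancy N x \<le> d"
  unfolding star_discrepancy_def
proof (rule cSUP_least)
  fix a :: real assume a: "a \<in> {0..1}"
  let ?S = "{n \<in> {1..N}. x n \<in> {0..<a}}"
  have "?S \<subseteq> {1..nat \<lfloor>real N * (a + d)\<rfloor>}"
  proof
    fix n assume n: "n \<in> ?S"
    then have "real n / real N \<le> a + d" using lower[of n] by auto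
    then have "real n \<le> real N * (a + d)" using assms(1) by (simp add: field_simps)
    then show "n \<in> {1..nat \<lfloor>real N * (a + d)\<rfloor>}" using n by (simp add: le_nat_floor)
  qed
  from card_mono[OF _ this] have "card ?S \<le> nat \<lfloor>real N * (a + d)\<rfloor>" by simp
  also have "real \<dots> \<le> real N * (a + d)" using a assms(1,2) by simp
  finally have 1: "real (card ?S) \<le> real N * (a + d)" by simp
  have "{1..nat \<lceil>real N * (a - d)\<rceil>} \<subseteq> ?S"
  proof
    fix n assume n: "n \<in> {1..nat \<lceil>real N * (a - d)\<rceil>}"
    have "real N * (a - d) \<le> real N * 1" using a assms(1,2) by (intro mult_left_mono) auto
    then have "\<lceil>real N * (a - d)\<rceil> \<le> int N" by (simp add: ceiling_le_iff)
    then have nN: "n \<in> {1..N}" using n by auto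
    have "int n \<le> \<lceil>real N * (a - d)\<rceil>" using n by auto
    \<comment> \<open>Strictness matters: it yields \<open>x n < a\<close>, as the half-open
      interval demands.\<close>
    then have "real n - 1 < real N * (a - d)" by linarith
    then have "(real n - 1) / real N < a - d" using assms(1) by (simp add: field_simps)
    then show "n \<in> ?S" using upper[OF nN] nonneg[OF nN] nN by auto
  qed
  then have "card {1..nat \<lceil>real N * (a - d)\<rceil>} \<le> card ?S" by (intro card_mono) auto
  then have 2: "real N * (a - d) \<le> real (card ?S)" by simp
  show "\<bar>real (counting_fun N x a) / real N - a\<bar> \<le> d"
    using 1 2 assms(1) unfolding counting_fun_def abs_le_iff by (simp add: field_simps)
qed auto

text \<open>Converse of \<open>star_discrepancy_leI\<close> for the sorted rearrangement, indexed
  from \<open>0\<close>. At most \<open>i\<close> points lie strictly below \<open>xs ! i\<close>,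
  and at least \<open>i + 1\<close> lie below any number just above it.\<close>

lemma star_discrepancy_sorted:
  assumes "N > 0" and len: "length xs = N" and "sorted xs"
    and xs: "mset xs = image_mset x (mset_set {1..N})"
    and unit: "set xs \<subseteq> {0..1}"
    and disc: "star_discrepancy N x \<le> d" and i: "i < N"
  shows "xs ! i \<le> real i / real N + d" "(real i + 1) / real N - d \<le> xs ! i"
proof -
  have count: "counting_fun N x a = card {j. j < N \<and> xs ! j < a}" for a
  proof -
    have "x n \<ge> 0" if "n \<in> {1..N}" for n
    proof -
      have "x n \<in> set xs" using that arg_cong[OF xs, of set_mset] by simp
      then show ?thesis using unit by auto
    qed
    then have "{n \<in> {1..N}. x n \<in> {0..<a}} = {n \<in> {1..N}. x n < a}" by auto
    then have "counting_fun N x a = size (filter_mset (\<lambda>y. y < a) (image_mset x (mset_set {1..N})))"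
      by (simp add: counting_fun_def filter_mset_image_mset filter_mset_mset_set)
    also have "\<dots> = length (filter (\<lambda>y. y < a) xs)"
      by (simp only: xs[symmetric] mset_filter[symmetric] size_mset)
    finally show ?thesis by (simp add: length_filter_conv_card len)
  qed
  have D: "\<bar>real (card {j. j < N \<and> xs ! j < a}) / real N - a\<bar> \<le> d" if "a \<in> {0..1}" for a
    using abs_le_star_discrepancy[OF assms(1) that, of x] disc by (simp add: count)
  have xi: "xs ! i \<in> {0..1}" using unit i len nth_mem by blast
  have "{j. j < N \<and> xs ! j < xs ! i} \<subseteq> {..<i}"
  proof
    fix j assume "j \<in> {j. j < N \<and> xs ! j < xs ! i}"
    then show "j \<in> {..<i}" using sorted_nth_mono[OF \<open>sorted xs\<close>, of i j] len by force
  qed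
  then have "card {j. j < N \<and> xs ! j < xs ! i} \<le> i"
    using card_mono[of "{..<i}"] by fastforce
  then have "real (card {j. j < N \<and> xs ! j < xs ! i}) / real N \<le> real i / real N"
    by (intro divide_right_mono) auto
  with D[OF xi] show "xs ! i \<le> real i / real N + d" by linarith
  show "(real i + 1) / real N - d \<le> xs ! i"
  proof (rule ccontr)
    define b where "b = (real i + 1) / real N - d"
    assume "\<not> ?thesis"
    then have b: "xs ! i < b" by (simp add: b_def)
    have "(real i + 1) / real N \<le> 1" using i by (simp add: field_simps)
    moreover have "0 \<le> d" using order_trans[OF abs_ge_zero D[of 0]] by simp
    ultimately have "b \<le> 1" by (simp add: b_def)
    \<comment> \<open>Testing at \<open>xs ! i\<close> itself would not count that point. A midpoint
      above it does, and still lies below \<open>b\<close>.\<close>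
    define a where "a = (xs ! i + b) / 2"
    have a: "xs ! i < a" "a < b" "a \<in> {0..1}" using b \<open>b \<le> 1\<close> xi by (auto simp: a_def)
    have "{..i} \<subseteq> {j. j < N \<and> xs ! j < a}"
      using a sorted_nth_mono[OF \<open>sorted xs\<close>, of _ i] i len by fastforce
    then have "Suc i \<le> card {j. j < N \<and> xs ! j < a}"
      using card_mono[of "{j. j < N \<and> xs ! j < a}" "{..i}"] by simp
    then have "(real i + 1) / real N \<le> real (card {j. j < N \<and> xs ! j < a}) / real N"
      by (intro divide_right_mono) auto
    with D[OF a(3)] a(2) show False by (simp add: b_def)
  qed
qed

text \<open>The product is symmetric, so the points may be sorted. The two bounds on the
  \<open>j\<close>-th point then limit its distance to either endpoint.\<close>

lemma sine_product_le_extremal: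
  assumes N: "N > 0" and x: "x \<in> admissible_point_sets N d"
  shows "(\<Prod>k=1..N. 2 * sin (pi * x k)) \<le> extremal_product N (real N * d)"
proof -
  define xs where "xs = sort (map x [1..<Suc N])"
  let ?f = "\<lambda>y. 2 * sin (pi * y)"
  have unit: "set xs \<subseteq> {0..1}" and disc: "star_discrepancy N x \<le> d"
    using x by (auto simp: xs_def admissible_point_sets_def)
  have mset_xs: "mset xs = image_mset x (mset_set {1..N})"
    by (simp only: xs_def mset_sort mset_map mset_upt atLeastLessThanSuc_atLeastAtMost)
  have len: "length xs = N" by (simp add: xs_def)
  have "(\<Prod>k=1..N. ?f (x k)) = prod_mset (image_mset ?f (mset xs))"
    by (simp only: mset_xs multiset.map_comp prod_unfold_prod_mset comp_def)
  also have "\<dots> = prod_list (map ?f xs)" by (metis mset_map prod_mset_prod_list)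
  also have "\<dots> = (\<Prod>j<N. ?f (xs ! j))"
    by (simp add: prod.list_conv_set_nth len atLeast0LessThan)
  also have "\<dots> \<le> extremal_product N (real N * d)"
    unfolding extremal_product_def
  proof (intro prod_mono conjI)
    fix j assume "j \<in> {..<N}"
    then have j: "j < N" by simp
    \<comment> \<open>The distance to the nearer endpoint gives the same sine and stays in the range
      where the sine is increasing.\<close>
    let ?y = "min (xs ! j) (1 - xs ! j)"
    have xj: "xs ! j \<in> {0..1}" using unit j len nth_mem by blast
    then show "0 \<le> ?f (xs ! j)" using mult_left_mono[of "xs ! j" 1 pi] by (auto intro!: sin_ge_zero)
    have 1: "xs ! j \<le> real j / real N + d" and 2: "(real j + 1) / real N - d \<le> xs ! j"
      using star_discrepancy_sorted[OF N len _ mset_xs unit disc j] by (auto simp: xs_def)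
    have "sin (pi * xs ! j) = sin (pi * ?y)"
      using sin_pi_minus[of "pi * xs ! j"] by (auto simp: min_def right_diff_distrib)
    also have "2 * \<dots> \<le> capped_sine N (real (min j (N - 1 - j)) + real N * d)"
    proof (rule sine_le_capped_sine)
      have "real j / real N + d = (real j + real N * d) / real N"
        "1 - ((real j + 1) / real N - d) = (real (N - 1 - j) + real N * d) / real N"
        using N j by (simp_all add: field_simps of_nat_diff)
      then have "?y \<le> (real j + real N * d) / real N" "?y \<le> (real (N - 1 - j) + real N * d) / real N"
        using 1 2 by linarith+
      moreover have "min j (N - 1 - j) = j \<or> min j (N - 1 - j) = N - 1 - j" by linarith
      ultimately show "?y \<le> (real (min j (N - 1 - j)) + real N * d) / real N"
        by (elim disjE) (simp_all only:)
      show "?y \<le> 1 / 2" by linarith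
    qed (use xj in auto)
    finally show "?f (xs ! j) \<le> \<dots>" by simp
  qed
  finally show ?thesis .
qed

text \<open>The first half of the points is placed at the capped distances from \<open>0\<close>,
  the second half at the capped distances from \<open>1\<close>. The family \<open>x\<close> counts
  from \<open>1\<close> and \<open>y\<close> from \<open>0\<close>.\<close>

lemma extremal_product_attained:
  assumes N: "N > 0" and d: "1 / (2 * real N) \<le> d"
  shows "\<exists>x\<in>admissible_point_sets N d. (\<Prod>k=1..N. 2 * sin (pi * x k)) = extremal_product N (real N * d)"
proof -
  define y where "y = (\<lambda>j. min ((real (min j (N - 1 - j)) + real N * d) / real N) (1 / 2))"
  define x where "x = (\<lambda>i. if i - 1 \<le> N - i then y (i - 1) else 1 - y (i - 1))"
  have d0: "0 \<le> d" using d N by (smt (verit) divide_nonneg_nonneg of_nat_0_le_iff)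
  have Nd: "1 \<le> 2 * real N * d" using d N by (simp add: field_simps)
  have y: "0 \<le> y j" "y j \<le> 1 / 2" for j
    using d0 unfolding y_def by (simp, intro min.cobounded2)
  have bounds: "real i / real N - d \<le> x i \<and> x i \<le> (real i - 1) / real N + d"
    if i: "i \<in> {1..N}" for i
  proof (cases "i - 1 \<le> N - i")
    case True
    then have "y (i - 1) = min ((real i - 1) / real N + d) (1 / 2)"
      using i N by (simp add: y_def add_divide_distrib of_nat_diff)
    \<comment> \<open>The assumption \<open>d \<ge> 1 / (2 * N)\<close> says that the interval
      allowed for the point is nonempty; it also keeps \<open>1 / 2\<close> above the lower end in
      the first half.\<close>
    moreover have "real i / real N - d \<le> (real i - 1) / real N + d" "real i / real N - d \<le> 1 / 2"
      using Nd N True i by (auto simp: field_simps)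
    ultimately show ?thesis using True by (simp add: x_def)
  next
    case False
    then have "y (i - 1) = min ((real N - real i) / real N + d) (1 / 2)"
      using i N by (simp add: y_def add_divide_distrib of_nat_diff)
    moreover have "(real N - real i) / real N = 1 - real i / real N"
      using N by (simp add: field_simps)
    moreover have "real i / real N - d \<le> (real i - 1) / real N + d" "1 / 2 \<le> (real i - 1) / real N + d"
      using Nd N False i by (auto simp: field_simps)
    ultimately have "real i / real N - d \<le> 1 - y (i - 1) \<and> 1 - y (i - 1) \<le> (real i - 1) / real N + d"
      by linarith
    then show ?thesis using False by (simp add: x_def)
  qed
  have unit: "x i \<in> {0..1}" for i
    using y[of "i - 1"] by (auto simp: x_def)
  have "star_discrepancy N x \<le> d"
    using bounds unit N d0 by (intro star_discrepancy_leI) auto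
  then have "x \<in> admissible_point_sets N d" using unit by (auto simp: admissible_point_sets_def)
  moreover have "(\<Prod>k=1..N. 2 * sin (pi * x k)) = extremal_product N (real N * d)"
  proof -
    have "(\<Prod>k=1..N. 2 * sin (pi * x k)) = (\<Prod>j<N. 2 * sin (pi * x (Suc j)))"
      by (simp add: prod.atLeast1_atMost_eq)
    also have "\<dots> = (\<Prod>j<N. 2 * sin (pi * y j))"
    proof (rule prod.cong[OF refl])
      fix j
      show "2 * sin (pi * x (Suc j)) = 2 * sin (pi * y j)"
        using sin_pi_minus[of "pi * y j"] by (auto simp: x_def right_diff_distrib)
    qed
    finally show ?thesis by (simp add: extremal_product_def capped_sine_def y_def)
  qed
  ultimately show ?thesis by blast
qed

lemma max_sine_product_eq:
  assumes N: "N > 0" and d: "1 / (2 * real N) \<le> d"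
  shows "max_sine_product N d = extremal_product N (real N * d)"
proof -
  obtain x where x: "x \<in> admissible_point_sets N d"
    "(\<Prod>k=1..N. 2 * sin (pi * x k)) = extremal_product N (real N * d)"
    using extremal_product_attained[OF assms] by blast
  show ?thesis
  proof (rule antisym)
    show "max_sine_product N d \<le> extremal_product N (real N * d)"
      unfolding max_sine_product_def
      using x sine_product_le_extremal[OF N] by (intro cSUP_least) auto
    show "extremal_product N (real N * d) \<le> max_sine_product N d"
      unfolding max_sine_product_def x(2)[symmetric]
      using x sine_product_le_extremal[OF N] by (intro cSUP_upper bdd_aboveI2) auto
  qed
qed

section \<open>Unit-step induction on reals and the comparison function\<close>

text \<open>Any \<open>M \<ge> a\<close> descends by unit steps into the base interval;
  \<open>a + 1 \<le> b\<close> keeps the descent above \<open>a\<close>. A larger \<open>b\<close>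
  confines the step to larger \<open>M\<close>.\<close>

lemma real_shift_induct:
  fixes P :: "real \<Rightarrow> bool"
  assumes base: "\<And>M. a \<le> M \<Longrightarrow> M \<le> b \<Longrightarrow> P M"
    and step: "\<And>M. a \<le> M \<Longrightarrow> b \<le> M + 1 \<Longrightarrow> P M \<Longrightarrow> P (M + 1)"
    and "a + 1 \<le> b" "a \<le> M"
  shows "P M"
proof -
  have "\<forall>M. a \<le> M \<longrightarrow> M \<le> b + real n \<longrightarrow> P M" for n
  proof (induction n)
    case 0
    then show ?case using base by simp
  next
    case (Suc n)
    show ?case
    proof (intro allI impI)
      fix M assume M: "a \<le> M" "M \<le> b + real (Suc n)"
      show "P M"
      proof (cases "M \<le> b")
        case False
        then have "P (M - 1)" using Suc M \<open>a + 1 \<le> b\<close> by auto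
        then show ?thesis using step[of "M - 1"] False M \<open>a + 1 \<le> b\<close> by simp
      qed (use base M in simp)
    qed
  qed
  moreover obtain n where "M - b \<le> real n" using real_arch_simple by blast
  ultimately show ?thesis using \<open>a \<le> M\<close> by (smt (verit))
qed

text \<open>With \<open>B = q * N\<close> and \<open>M = N * d\<close> this is the power of
  \<open>q / d\<close> with exponent \<open>2 * N * d\<close> from the theorem.\<close>

definition envelope :: "real \<Rightarrow> real \<Rightarrow> real" where
  "envelope B M = (B / M) powr (2 * M)"

text \<open>Exact growth under a unit step. The extra factor tends to \<open>exp 2\<close>, and the
  two one-sided estimates below compare it with that limit.\<close>

lemma envelope_Suc:
  assumes "B > 0" "M > 0"
  shows "envelope B (M + 1) * ((M + 1) / M) powr (2 * M) = envelope B M * (B / (M + 1))\<^sup>2"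
proof -
  have "envelope B (M + 1) = (B / (M + 1)) powr (2 * M) * (B / (M + 1))\<^sup>2"
    using assms by (simp add: envelope_def powr_add distrib_left flip: powr_numeral)
  moreover have "(B / (M + 1)) powr (2 * M) * ((M + 1) / M) powr (2 * M) = envelope B M"
    using assms unfolding envelope_def powr_mult[symmetric] by simp
  ultimately show ?thesis by (simp add: mult_ac)
qed

lemma square_divide_exp: "(B / (exp 1 * x))\<^sup>2 = (B / x)\<^sup>2 / exp 2" for B x :: real
proof -
  have "exp (2::real) = (exp 1)\<^sup>2" by (simp add: power2_eq_square mult_exp_exp)
  then show ?thesis by (simp add: power_divide power_mult_distrib)
qed

text \<open>This is \<open>(1 + 1 / M) powr (2 * M) \<le> exp 2\<close>, from
  \<open>ln x \<le> x - 1\<close>.\<close>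

lemma envelope_Suc_ge:
  assumes "B > 0" "M > 0"
  shows "envelope B M * (B / (exp 1 * (M + 1)))\<^sup>2 \<le> envelope B (M + 1)"
proof -
  have "ln ((M + 1) / M) \<le> 1 / M"
    using ln_le_minus_one[of "(M + 1) / M"] assms by (simp add: field_simps)
  then have "2 * M * ln ((M + 1) / M) \<le> 2" using assms by (simp add: field_simps)
  then have "((M + 1) / M) powr (2 * M) \<le> exp 2" using assms by (simp add: powr_def)
  then have "envelope B (M + 1) * ((M + 1) / M) powr (2 * M) \<le> envelope B (M + 1) * exp 2"
    by (intro mult_left_mono) (auto simp: envelope_def)
  then have "envelope B M * (B / (M + 1))\<^sup>2 \<le> envelope B (M + 1) * exp 2"
    using envelope_Suc[OF assms] by simp
  then show ?thesis unfolding square_divide_exp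
    by (simp only: times_divide_eq_right pos_divide_le_eq pos_le_divide_eq exp_gt_zero)
qed

text \<open>This is \<open>(1 + 1 / M) powr (2 * (M + 1)) \<ge> exp 2\<close>; the two additional
  powers turn \<open>M + 1\<close> in the denominator into \<open>M\<close>.\<close>

lemma envelope_Suc_le:
  assumes "B > 0" "M > 0"
  shows "envelope B (M + 1) \<le> envelope B M * (B / (exp 1 * M))\<^sup>2"
proof -
  let ?r = "(M + 1) / M"
  have "ln (M / (M + 1)) \<le> - (1 / (M + 1))"
    using ln_le_minus_one[of "M / (M + 1)"] assms by (simp add: field_simps)
  then have "1 \<le> (M + 1) * ln ?r" using assms by (simp add: ln_div field_simps)
  then have "exp 2 \<le> ?r powr (2 * (M + 1))" using assms by (simp add: powr_def algebra_simps)
  also have "\<dots> = ?r powr (2 * M) * ?r\<^sup>2"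
    using assms by (simp add: powr_add distrib_left flip: powr_numeral)
  finally have "envelope B (M + 1) * exp 2 \<le> envelope B (M + 1) * (?r powr (2 * M) * ?r\<^sup>2)"
    by (intro mult_left_mono) (auto simp: envelope_def)
  also have "\<dots> = envelope B M * ((B / (M + 1))\<^sup>2 * ?r\<^sup>2)"
    using envelope_Suc[OF assms] by (simp flip: mult.assoc)
  also have "(B / (M + 1))\<^sup>2 * ?r\<^sup>2 = (B / M)\<^sup>2"
    using assms by (simp flip: power_mult_distrib)
  finally have "envelope B (M + 1) * exp 2 \<le> envelope B M * (B / M)\<^sup>2" .
  then show ?thesis unfolding square_divide_exp
    by (simp only: times_divide_eq_right pos_divide_le_eq pos_le_divide_eq exp_gt_zero)
qed

text \<open>Separates the power of \<open>N\<close> from a factor that is bounded for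
  \<open>M\<close> in a compact range, as the base cases require.\<close>

lemma envelope_eq:
  assumes "N > 0" "q > 0" "M > 0"
  shows "envelope (q * N) M / N = N powr (2 * M - 1) * (q / M) powr (2 * M)"
proof -
  have "envelope (q * N) M = (N * (q / M)) powr (2 * M)" by (simp add: envelope_def mult_ac)
  also have "\<dots> = N powr (2 * M) * (q / M) powr (2 * M)" by (rule powr_mult)
  finally show ?thesis using assms by (simp add: powr_diff)
qed

section \<open>Growth of the extremal product and its lower bound\<close>

lemma extremal_product_Suc_ge:
  assumes "N > 0" "M \<ge> 1 / 2"
  shows "extremal_product N M * (real N / (pi * M))\<^sup>2 \<le> extremal_product N (M + 1)"
proof -
  have "capped_sine N M > 0" using assms by (intro capped_sine_pos) auto
  then have "real N / (pi * M) \<le> 2 / capped_sine N M"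
    using capped_sine_le[of N M] assms by (simp add: field_simps)
  then show ?thesis
    unfolding extremal_product_Suc[OF assms] using assms extremal_product_pos[of N M]
    by (intro mult_left_mono power_mono) auto
qed

text \<open>A crude bound from Jordan's inequality at \<open>M \<ge> 1 / 2\<close>; it serves to
  control bounded \<open>M\<close>.\<close>

lemma extremal_product_Suc_le:
  assumes "N > 0" "M \<ge> 1 / 2"
  shows "extremal_product N (M + 1) \<le> extremal_product N M * (real N)\<^sup>2"
proof -
  have pos: "capped_sine N M > 0" using assms by (intro capped_sine_pos) auto
  have "1 / (2 * real N) \<le> M / real N" "1 / (2 * real N) \<le> 1 / 2"
    using assms by (simp_all add: field_simps)
  then have "2 / real N \<le> 4 * min (M / real N) (1 / 2)" by (simp add: min_def)
  also have "\<dots> \<le> capped_sine N M" using assms by (intro capped_sine_ge) auto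
  finally have "2 / capped_sine N M \<le> real N" using pos assms by (simp add: field_simps)
  then show ?thesis
    unfolding extremal_product_Suc[OF assms] using pos assms extremal_product_pos[of N M]
    by (intro mult_left_mono power_mono) auto
qed

text \<open>Between \<open>1 / 2\<close> and \<open>3 / 2\<close> log-concavity interpolates the
  values at the two ends. Beyond, the extremal product gains at least, and the envelope at most, the
  same factor per unit step.\<close>

lemma extremal_product_ge_envelope:
  assumes N: "N > 0" and M: "M \<ge> 1 / 2"
  shows "1 / pi\<^sup>2 * (envelope (exp 1 / pi * real N) M / real N) \<le> extremal_product N M"
proof (rule real_shift_induct[where P = "\<lambda>M. 1 / pi\<^sup>2 * (envelope (exp 1 / pi * real N) M / real N)
      \<le> extremal_product N M" and a = "1 / 2" and b = "3 / 2"])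
  fix t :: real assume t: "1 / 2 \<le> t" "t \<le> 3 / 2"
  \<comment> \<open>From the value \<open>2\<close> at \<open>1 / 2\<close>, one step gives at least
    \<open>2 * (2 * N / pi)\<^sup>2 = k * N\<^sup>2\<close> at \<open>3 / 2\<close>; also
    \<open>k \<le> 2\<close>, so one constant fits both ends.\<close>
  define k where "k = 8 / pi\<^sup>2"
  have "(2::real)\<^sup>2 \<le> pi\<^sup>2" by (intro power_mono pi_ge_two) simp
  then have k: "0 < k" "k \<le> extremal_product N (1 / 2)"
    unfolding extremal_product_half[OF N] by (auto simp: k_def field_simps)
  have k': "k * real N powr 2 \<le> extremal_product N (3 / 2)"
    using extremal_product_Suc_ge[of N "1 / 2"] N extremal_product_half[OF N]
    by (simp add: k_def power_divide power_mult_distrib field_simps)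
  have "k * real N powr (2 * t - 1) = k powr (3 / 2 - t) * (k * real N powr 2) powr (t - 1 / 2)"
  proof -
    have "k = k powr (3 / 2 - t) * k powr (t - 1 / 2)" using k(1) by (simp flip: powr_add)
    moreover have "real N powr (2 * t - 1) = (real N powr 2) powr (t - 1 / 2)"
      unfolding powr_powr by (simp add: right_diff_distrib)
    ultimately have "k * real N powr (2 * t - 1)
        = (k powr (3 / 2 - t) * k powr (t - 1 / 2)) * (real N powr 2) powr (t - 1 / 2)"
      by (rule arg_cong2[where f = "(*)"])
    then show ?thesis by (simp only: powr_mult mult.assoc)
  qed
  also have "\<dots> \<le> extremal_product N (1 / 2) powr (3 / 2 - t) * extremal_product N (3 / 2) powr (t - 1 / 2)"
    using k k' t by (intro mult_mono powr_mono2) auto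
  also have "\<dots> \<le> extremal_product N ((3 / 2 - t) * (1 / 2) + (t - 1 / 2) * (3 / 2))"
    using N t by (intro extremal_product_log_concave) auto
  also have "(3 / 2 - t) * (1 / 2) + (t - 1 / 2) * (3 / 2) = t" by (simp add: field_simps)
  finally have lower: "k * real N powr (2 * t - 1) \<le> extremal_product N t" .
  \<comment> \<open>Base at most \<open>2\<close> and exponent at most \<open>3\<close> give the
    bound \<open>8\<close>, which turns \<open>k\<close> into the constant
    \<open>1 / pi\<^sup>2\<close>.\<close>
  have "exp 1 / pi \<le> 1" using exp_le pi_gt3 by (simp add: field_simps)
  then have "exp 1 / pi / t \<le> 1 / t" using t by (intro divide_right_mono) auto
  also have "\<dots> \<le> 2" using t by (simp add: field_simps)
  finally have "exp 1 / pi / t \<le> 2" .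
  then have "(exp 1 / pi / t) powr (2 * t) \<le> 2 powr (2 * t)"
    using t by (intro powr_mono2) auto
  also have "\<dots> \<le> 2 powr 3" using t by (intro powr_mono) auto
  finally have "(exp 1 / pi / t) powr (2 * t) \<le> 8" by simp
  then have "real N powr (2 * t - 1) * (exp 1 / pi / t) powr (2 * t) \<le> real N powr (2 * t - 1) * 8"
    by (intro mult_left_mono) auto
  then have "1 / pi\<^sup>2 * (envelope (exp 1 / pi * real N) t / real N) \<le> 1 / pi\<^sup>2 * (real N powr (2 * t - 1) * 8)"
    using N t by (subst envelope_eq) (auto intro!: divide_right_mono)
  also have "\<dots> = k * real N powr (2 * t - 1)" by (simp add: k_def)
  finally show "1 / pi\<^sup>2 * (envelope (exp 1 / pi * real N) t / real N) \<le> extremal_product N t"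
    using lower by linarith
next
  fix M :: real assume M: "1 / 2 \<le> M"
    and IH: "1 / pi\<^sup>2 * (envelope (exp 1 / pi * real N) M / real N) \<le> extremal_product N M"
  have "envelope (exp 1 / pi * real N) (M + 1)
      \<le> envelope (exp 1 / pi * real N) M * (exp 1 / pi * real N / (exp 1 * M))\<^sup>2"
    using N M by (intro envelope_Suc_le) auto
  \<comment> \<open>The choice \<open>q = exp 1 / pi\<close> makes the two growth factors coincide,
    so the constant survives every step.\<close>
  also have "exp 1 / pi * real N / (exp 1 * M) = real N / (pi * M)" by simp
  finally have "1 / pi\<^sup>2 * (envelope (exp 1 / pi * real N) (M + 1) / real N)
      \<le> 1 / pi\<^sup>2 * (envelope (exp 1 / pi * real N) M * (real N / (pi * M))\<^sup>2 / real N)"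
    by (intro mult_left_mono divide_right_mono) auto
  also have "\<dots> = 1 / pi\<^sup>2 * (envelope (exp 1 / pi * real N) M / real N) * (real N / (pi * M))\<^sup>2"
    by simp
  also have "\<dots> \<le> extremal_product N M * (real N / (pi * M))\<^sup>2"
    by (intro mult_right_mono IH) auto
  also have "\<dots> \<le> extremal_product N (M + 1)" using N M by (rule extremal_product_Suc_ge)
  finally show "1 / pi\<^sup>2 * (envelope (exp 1 / pi * real N) (M + 1) / real N) \<le> extremal_product N (M + 1)" .
qed (use M in auto)

section \<open>Upper bound for the extremal product\<close>

text \<open>For \<open>t\<close> in the base interval, \<open>3 / 2\<close> lies between
  \<open>t\<close> and \<open>t + 1\<close>. Log-concavity and the growth from \<open>t\<close> to
  \<open>t + 1\<close> bound the value at \<open>t\<close> by the known one at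
  \<open>3 / 2\<close>.\<close>

lemma extremal_product_le_power:
  assumes N: "N > 0" and M: "M \<ge> 1 / 2"
  shows "extremal_product N M \<le> 72 * real N powr (2 * M - 1)"
proof (rule real_shift_induct[where P = "\<lambda>M. extremal_product N M \<le> 72 * real N powr (2 * M - 1)"
      and a = "1 / 2" and b = "3 / 2"])
  fix t :: real assume t: "1 / 2 \<le> t" "t \<le> 3 / 2"
  \<comment> \<open>The weight for which \<open>(1 - v) * t + v * (t + 1) = 3 / 2\<close>.\<close>
  define v where "v = 3 / 2 - t"
  have v: "0 \<le> v" "v \<le> 1" using t by (auto simp: v_def)
  let ?T = "extremal_product N"
  have T: "?T t > 0" using N t by (intro extremal_product_pos) auto
  have "?T t * (real N / (pi * t)) powr (2 * v) = ?T t powr (1 - v) * (?T t * (real N / (pi * t)) powr 2) powr v"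
    using T by (simp add: powr_mult powr_powr flip: powr_add mult.assoc)
  also have "\<dots> \<le> ?T t powr (1 - v) * ?T (t + 1) powr v"
    using extremal_product_Suc_ge[OF N t(1)] T v N t
    by (intro mult_left_mono powr_mono2) auto
  also have "\<dots> \<le> ?T ((1 - v) * t + v * (t + 1))"
    using N t v by (intro extremal_product_log_concave) auto
  also have "(1 - v) * t + v * (t + 1) = 1 / 2 + 1" by (simp add: v_def algebra_simps)
  also have "?T (1 / 2 + 1) \<le> 2 * (real N)\<^sup>2"
    using extremal_product_Suc_le[of N "1 / 2"] N extremal_product_half[OF N] by simp
  finally have 1: "?T t * (real N / (pi * t)) powr (2 * v) \<le> 2 * (real N)\<^sup>2" .
  \<comment> \<open>The constant is \<open>72 = 2 * 36\<close>: \<open>2\<close> from the value at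
    \<open>1 / 2\<close>, and \<open>36\<close> from \<open>pi * t \<le> 6\<close> with exponent at
    most \<open>2\<close>.\<close>
  have "pi * t \<le> 4 * (3 / 2)" using t pi_less_4 by (intro mult_mono) auto
  then have "(pi * t) powr (2 * v) \<le> 6 powr (2 * v)" using t v by (intro powr_mono2) auto
  also have "\<dots> \<le> 6 powr 2" using v by (intro powr_mono) auto
  finally have 2: "(pi * t) powr (2 * v) \<le> 36" by simp
  have "?T t * real N powr (2 * v) = ?T t * (real N / (pi * t)) powr (2 * v) * (pi * t) powr (2 * v)"
    using t by (simp flip: powr_mult mult.assoc add: mult.assoc)
  also have "\<dots> \<le> 2 * (real N)\<^sup>2 * 36" using T by (intro mult_mono 1 2) auto
  finally have "?T t \<le> 72 * (real N powr 2 / real N powr (2 * v))"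
    using N by (simp add: field_simps)
  also have "real N powr 2 / real N powr (2 * v) = real N powr (2 * t - 1)"
    unfolding powr_diff[symmetric] by (simp add: v_def algebra_simps)
  finally show "?T t \<le> 72 * real N powr (2 * t - 1)" .
next
  fix M :: real assume M: "1 / 2 \<le> M" and IH: "extremal_product N M \<le> 72 * real N powr (2 * M - 1)"
  have "extremal_product N (M + 1) \<le> extremal_product N M * (real N)\<^sup>2"
    using N M by (rule extremal_product_Suc_le)
  also have "\<dots> \<le> 72 * real N powr (2 * M - 1) * (real N)\<^sup>2" by (intro mult_right_mono IH) auto
  also have "\<dots> = 72 * real N powr (2 * (M + 1) - 1)"
  proof -
    have "2 * (M + 1) - 1 = 2 * M - 1 + 2" by simp
    then show ?thesis using N by (simp only: powr_add) simp
  qed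
  finally show "extremal_product N (M + 1) \<le> 72 * real N powr (2 * (M + 1) - 1)" .
qed (use M in auto)

text \<open>The derivative of the sine at \<open>0\<close> is \<open>1\<close>, which exceeds
  \<open>1 / s\<close>.\<close>

lemma sin_ge_slope:
  fixes s :: real
  assumes "s > 1"
  obtains y\<^sub>0 where "0 < y\<^sub>0" "\<And>y. 0 < y \<Longrightarrow> y \<le> y\<^sub>0 \<Longrightarrow> y / s \<le> sin y"
proof -
  have "((\<lambda>y. sin y / y) \<longlongrightarrow> 1) (at (0::real))"
    using DERIV_sin[of "0::real"] by (simp add: has_field_derivative_iff)
  then have "\<forall>\<^sub>F y in at (0::real). 1 / s < sin y / y"
    using assms by (intro order_tendstoD) auto
  then obtain r where r: "r > 0" "\<And>y. y \<noteq> 0 \<Longrightarrow> dist y 0 < r \<Longrightarrow> 1 / s < sin y / y"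
    unfolding eventually_at by auto
  show thesis
  proof
    show "y / s \<le> sin y" if "0 < y" "y \<le> r / 2" for y
      using r(2)[of y] r(1) that by (simp add: field_simps)
  qed (use r in simp)
qed

text \<open>For bounded \<open>M\<close> the power bound suffices. For larger \<open>M\<close> with
  \<open>M / N\<close> small, the excess of \<open>q\<close> over \<open>exp 1 / pi\<close> lets the
  envelope grow at least as fast per unit step.\<close>

lemma extremal_product_le_envelope:
  assumes q: "q > exp 1 / pi"
  obtains c x\<^sub>0 where "0 < x\<^sub>0"
    "\<And>N M. N > 0 \<Longrightarrow> 1 / 2 \<le> M \<Longrightarrow> M \<le> x\<^sub>0 * real N \<Longrightarrow>
      extremal_product N M \<le> c * (envelope (q * real N) M / real N)"
proof -
  \<comment> \<open>The slack \<open>q * pi / exp 1\<close> is split evenly: one factor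
    \<open>s\<close> pays for \<open>sin y \<ge> y / s\<close>, the other for
    \<open>(M + 1) / s \<le> M\<close>.\<close>
  define s where "s = sqrt (q * pi / exp 1)"
  have q0: "q > 0" using q by (smt (verit) divide_pos_pos exp_gt_zero pi_gt_zero)
  have s: "s > 1" using q by (simp add: s_def field_simps)
  have s2: "s\<^sup>2 = q * pi / exp 1" using q0 by (simp add: s_def)
  obtain y\<^sub>0 where y0: "0 < y\<^sub>0" "\<And>y. 0 < y \<Longrightarrow> y \<le> y\<^sub>0 \<Longrightarrow> y / s \<le> sin y"
    using sin_ge_slope[OF s] by blast
  \<comment> \<open>The first term keeps \<open>pi * M / N\<close> where the slope estimate holds,
    the second keeps \<open>M / N\<close> below the cap.\<close>
  define x\<^sub>0 where "x\<^sub>0 = min (y\<^sub>0 / pi) (1 / 2)"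
  \<comment> \<open>For \<open>M \<ge> K - 1\<close> the second term gives
    \<open>(M + 1) / s \<le> M\<close>; the value \<open>3 / 2\<close> makes the base interval long
    enough.\<close>
  define K where "K = max (3 / 2) (1 / (s - 1) + 1)"
  \<comment> \<open>A lower bound for \<open>q / M\<close> when \<open>M \<le> K\<close>; being at
    most \<open>1\<close>, its power is smallest at the largest exponent
    \<open>2 * K\<close>.\<close>
  define w where "w = min 1 (q / K)"
  have K: "K \<ge> 3 / 2" "K \<ge> 1 / (s - 1) + 1" by (auto simp: K_def)
  have w: "0 < w" "w \<le> 1" "w \<le> q / K" using q0 K by (auto simp: w_def)
  define c where "c = 72 / w powr (2 * K)"
  show thesis
  proof
    show "0 < x\<^sub>0" using y0 by (simp add: x\<^sub>0_def)
    fix N :: nat and M :: real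
    assume N: "N > 0" and M: "1 / 2 \<le> M" and MN: "M \<le> x\<^sub>0 * real N"
    \<comment> \<open>The range condition sits inside the predicate because it passes from
      \<open>M + 1\<close> down to \<open>M\<close>.\<close>
    let ?P = "\<lambda>M. M \<le> x\<^sub>0 * real N \<longrightarrow> extremal_product N M \<le> c * (envelope (q * real N) M / real N)"
    have "?P M"
    proof (rule real_shift_induct[where P = ?P and a = "1 / 2" and b = K])
      fix M :: real assume M: "1 / 2 \<le> M" "M \<le> K"
      have "w powr (2 * K) \<le> w powr (2 * M)" using w M by (intro powr_mono') auto
      also have "q / K \<le> q / M" using M q0 by (intro divide_left_mono) auto
      then have "w powr (2 * M) \<le> (q / M) powr (2 * M)" using w M by (intro powr_mono2) auto
      finally have "w powr (2 * K) * real N powr (2 * M - 1) \<le> real N powr (2 * M - 1) * (q / M) powr (2 * M)"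
        by (subst mult.commute) (intro mult_left_mono, auto)
      then have "w powr (2 * K) * real N powr (2 * M - 1) \<le> envelope (q * real N) M / real N"
        using N M q0 by (simp add: envelope_eq)
      moreover have "72 * real N powr (2 * M - 1) = c * (w powr (2 * K) * real N powr (2 * M - 1))"
        using w(1) by (simp add: c_def)
      moreover have "0 \<le> c" by (simp add: c_def)
      ultimately have "72 * real N powr (2 * M - 1) \<le> c * (envelope (q * real N) M / real N)"
        by (simp only: mult_left_mono)
      then show "?P M" using extremal_product_le_power[OF N M(1)] by linarith
    next
      fix M :: real assume M: "1 / 2 \<le> M" "K \<le> M + 1" and IH: "?P M"
      show "?P (M + 1)"
      proof
        assume "M + 1 \<le> x\<^sub>0 * real N"
        then have MN: "M \<le> x\<^sub>0 * real N" by simp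
        then have x: "M / real N \<le> x\<^sub>0" using N by (simp add: field_simps)
        have "1 / (s - 1) \<le> M" using K M by linarith
        then have "(M + 1) / s \<le> M" using s by (simp add: field_simps)
        then have "(M + 1) / s * (pi / (real N * s)) \<le> M * (pi / (real N * s))"
          using s by (intro mult_right_mono) auto
        also have "\<dots> = pi * (M / real N) / s" by simp
        also have "\<dots> \<le> sin (pi * (M / real N))"
        proof (rule y0(2))
          have "M / real N \<le> y\<^sub>0 / pi" using x by (simp add: x\<^sub>0_def)
          then show "pi * (M / real N) \<le> y\<^sub>0" by (simp add: field_simps)
        qed (use M N in auto)
        also have "\<dots> = capped_sine N M / 2"
          using x by (simp add: capped_sine_def x\<^sub>0_def min_absorb1)
        finally have "(M + 1) * pi / (real N * s\<^sup>2) \<le> capped_sine N M / 2"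
          by (simp add: power2_eq_square mult_ac)
        then have "exp 1 * (M + 1) / (q * real N) \<le> capped_sine N M / 2"
          by (simp add: s2 mult_ac)
        then have "inverse (capped_sine N M / 2) \<le> inverse (exp 1 * (M + 1) / (q * real N))"
          using M N q0 by (intro le_imp_inverse_le) auto
        then have step: "2 / capped_sine N M \<le> q * real N / (exp 1 * (M + 1))" by simp
        have "capped_sine N M > 0" using N M by (intro capped_sine_pos) auto
        have "extremal_product N (M + 1) = extremal_product N M * (2 / capped_sine N M)\<^sup>2"
          using N M by (intro extremal_product_Suc) auto
        also have "\<dots> \<le> c * (envelope (q * real N) M / real N) * (q * real N / (exp 1 * (M + 1)))\<^sup>2"
          using IH MN step \<open>capped_sine N M > 0\<close> extremal_product_pos[of N M] N M
          by (intro mult_mono power_mono) auto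
        also have "\<dots> = c / real N * (envelope (q * real N) M * (q * real N / (exp 1 * (M + 1)))\<^sup>2)"
          by simp
        also have "\<dots> \<le> c / real N * envelope (q * real N) (M + 1)"
          using q0 N M w by (intro mult_left_mono envelope_Suc_ge) (auto simp: c_def)
        finally show "extremal_product N (M + 1) \<le> c * (envelope (q * real N) (M + 1) / real N)" by simp
      qed
    qed (use K M in auto)
    then show "extremal_product N M \<le> c * (envelope (q * real N) M / real N)" using MN by blast
  qed
qed

section \<open>The numerical constant and the asymptotic bounds\<close>

text \<open>Equivalent to \<open>2 * pi ^ 4 \<le> exp 6\<close>, for which
  \<open>pi \<le> 3.15\<close> and \<open>exp 1 \<ge> 1 + 1 + 1 / 2\<close> are sharp
  enough.\<close>

lemma two_pi_sq_over_exp6_le: "2 * pi\<^sup>2 / exp 6 \<le> 1 / pi\<^sup>2"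
proof -
  have "pi ^ 4 \<le> 3.15 ^ 4" using pi_approx by (intro power_mono) auto
  moreover have "(5 / 2) ^ 6 \<le> exp (1::real) ^ 6"
    using exp_lower_Taylor_quadratic[of "1::real"] by (intro power_mono) auto
  moreover have "exp (1::real) ^ 6 = exp 6" by (simp flip: exp_of_nat_mult)
  ultimately have "2 * pi ^ 4 \<le> exp 6" by (simp add: field_simps)
  then show ?thesis by (simp add: field_simps power_numeral_reduce)
qed

theorem theorem2:
  fixes d :: "nat \<Rightarrow> real"
  assumes d_bounds: "\<And>N. N \<ge> 1 \<Longrightarrow> 1 / (2 * real N) \<le> d N \<and> d N \<le> 1"
    and d_lim: "d \<longlonglongrightarrow> 0"
  shows "(\<forall>\<epsilon>>0. \<exists>(c::real) (N\<^sub>0::nat). \<forall>N>N\<^sub>0.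
            max_sine_product N (d N)
              \<le> c * (1 / real N) * ((exp 1 / pi + \<epsilon>) * (1 / d N)) powr (2 * real N * d N))
       \<and> (\<forall>\<^sub>F N in sequentially.
            max_sine_product N (d N)
              \<ge> (2 * pi\<^sup>2 / exp 6) * (1 / real N) * ((exp 1 / pi) * (1 / d N)) powr (2 * real N * d N))"
proof (intro conjI allI impI)
  have sup: "max_sine_product N (d N) = extremal_product N (real N * d N)" if "N > 0" for N
    using d_bounds[of N] that by (intro max_sine_product_eq) auto
  have half: "1 / 2 \<le> real N * d N" if "N > 0" for N
    using d_bounds[of N] that by (simp add: field_simps)
  have env: "envelope (q * real N) (real N * d N) = (q * (1 / d N)) powr (2 * real N * d N)"
    if "N > 0" for q N
    using that by (simp add: envelope_def mult.assoc)
  show "\<forall>\<^sub>F N in sequentially. max_sine_product N (d N)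
      \<ge> (2 * pi\<^sup>2 / exp 6) * (1 / real N) * ((exp 1 / pi) * (1 / d N)) powr (2 * real N * d N)"
    using eventually_gt_at_top[of 0]
  proof eventually_elim
    case (elim N)
    have "(2 * pi\<^sup>2 / exp 6) * (1 / real N) * ((exp 1 / pi) * (1 / d N)) powr (2 * real N * d N)
        = (2 * pi\<^sup>2 / exp 6) * (envelope (exp 1 / pi * real N) (real N * d N) / real N)"
      by (simp only: env[OF elim]) simp
    also have "\<dots> \<le> 1 / pi\<^sup>2 * (envelope (exp 1 / pi * real N) (real N * d N) / real N)"
      by (intro mult_right_mono two_pi_sq_over_exp6_le) (simp add: envelope_def)
    also have "\<dots> \<le> max_sine_product N (d N)"
      unfolding sup[OF elim] using elim half by (intro extremal_product_ge_envelope)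
    finally show ?case .
  qed
  fix \<epsilon> :: real assume "\<epsilon> > 0"
  then obtain c x\<^sub>0 where x0: "0 < x\<^sub>0" and c: "\<And>N M. N > 0 \<Longrightarrow> 1 / 2 \<le> M \<Longrightarrow> M \<le> x\<^sub>0 * real N \<Longrightarrow>
      extremal_product N M \<le> c * (envelope ((exp 1 / pi + \<epsilon>) * real N) M / real N)"
    using extremal_product_le_envelope[of "exp 1 / pi + \<epsilon>"] by (metis less_add_same_cancel1)
  \<comment> \<open>The limit of \<open>d\<close> brings \<open>M = N * d N\<close> into the range
    \<open>M \<le> x\<^sub>0 * N\<close> of the upper bound.\<close>
  have "\<forall>\<^sub>F N in sequentially. d N < x\<^sub>0" using order_tendstoD(2)[OF d_lim x0] .
  then obtain N\<^sub>0 where N0: "\<And>N. N \<ge> N\<^sub>0 \<Longrightarrow> d N < x\<^sub>0" unfolding eventually_sequentially by blast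
  show "\<exists>(c::real) (N\<^sub>0::nat). \<forall>N>N\<^sub>0. max_sine_product N (d N)
      \<le> c * (1 / real N) * ((exp 1 / pi + \<epsilon>) * (1 / d N)) powr (2 * real N * d N)"
  proof (intro exI allI impI)
    fix N assume "N > N\<^sub>0"
    then have N: "N > 0" and "d N \<le> x\<^sub>0" using N0[of N] by auto
    then have "real N * d N \<le> x\<^sub>0 * real N" by (subst mult.commute) (intro mult_right_mono, auto)
    then show "max_sine_product N (d N)
        \<le> c * (1 / real N) * ((exp 1 / pi + \<epsilon>) * (1 / d N)) powr (2 * real N * d N)"
      using c[OF N half[OF N]] unfolding env[OF N] sup[OF N] by simp
  qed
qed

end
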